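(* Let $\mathcal{H}$ be a complex Hilbert space and let $T_1,T_2\in\mathbb{B}(\mathcal{H})$. Then $$\omega\left(\begin{bmatrix} O & T_1\\ T_2^{*} & O\end{bmatrix}\right)\le \frac{1}{\sqrt{2}}\,\left\|(T_1,T_2)\right\|_{e}.$$
   Context: $\mathbb{B}(\mathcal{H})$ is the $C^*$-algebra of all bounded linear operators on $\mathcal{H}$, $\|\cdot\|$ is the operator norm, and $O$ is the zero operator. The numerical radius of an operator $T$ on a Hilbert space is $\omega(T)=\sup_{\|x\|=1}|\langle Tx,x\rangle|$. A $2\times2$ operator matrix with entries in $\mathbb{B}(\mathcal{H})$ is regarded as an operator on the Hilbert space $\mathcal{H}\oplus\mathcal{H}$. For $T_1,T_2\in\mathbb{B}(\mathcal{H})$, the Euclidean operator norm of the pair is $\|(T_1,T_2)\|_e=\sup\{\|\lambda_1T_1+\lambda_2T_2\| : \lambda_1,\lambda_2\in\mathbb{C},\ |\lambda_1|^2+|\lambda_2|^2=1\}$. *)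

theory Defs
  imports "HOL-Analysis.Analysis"
begin

class complex_vector = real_vector +
  fixes scaleC :: "complex \<Rightarrow> 'a \<Rightarrow> 'a"  (infixr \<open>*\<^sub>C\<close> 75)
  assumes scaleC_add_right: "c *\<^sub>C (x + y) = c *\<^sub>C x + c *\<^sub>C y"
    and scaleC_add_left: "(c + d) *\<^sub>C x = c *\<^sub>C x + d *\<^sub>C x"
    and scaleC_scaleC: "c *\<^sub>C d *\<^sub>C x = (c * d) *\<^sub>C x"
    and scaleR_scaleC: "r *\<^sub>R x = complex_of_real r *\<^sub>C x"

text \<open>The inner product is linear in the first and conjugate-linear in the second argument.
  The real part of \<open>cinner x x\<close> is its value, since \<open>cinner_commute\<close> makes it real;
  nonnegativity and definiteness follow from the last axiom because \<open>norm\<close> is a norm.\<close>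

class complex_inner = complex_vector + real_normed_vector +
  fixes cinner :: "'a \<Rightarrow> 'a \<Rightarrow> complex"
  assumes cinner_commute: "cinner x y = cnj (cinner y x)"
    and cinner_add_left: "cinner (x + y) z = cinner x z + cinner y z"
    and cinner_scaleC_left: "cinner (c *\<^sub>C x) y = c * cinner x y"
    and norm_eq_sqrt_cinner: "norm x = sqrt (Re (cinner x x))"

class chilbert_space = complex_inner + complete_space

instantiation complex :: chilbert_space
begin

definition scaleC_complex :: "complex \<Rightarrow> complex \<Rightarrow> complex"
  where "scaleC_complex c x = c * x"

definition cinner_complex :: "complex \<Rightarrow> complex \<Rightarrow> complex"
  where "cinner_complex x y = x * cnj y"

instance
  by standard
    (auto simp: scaleC_complex_def cinner_complex_def algebra_simps scaleR_conv_of_real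
      cmod_def power2_eq_square)

end

text \<open>The Hilbert space direct sum. The norm of the library's product type is already the
  \<open>\<ell>\<^sup>2\<close> norm \<open>sqrt ((norm x)\<^sup>2 + (norm y)\<^sup>2)\<close>.\<close>

instantiation prod :: (complex_vector, complex_vector) complex_vector
begin

definition scaleC_prod :: "complex \<Rightarrow> 'a \<times> 'b \<Rightarrow> 'a \<times> 'b"
  where "scaleC_prod c p = (c *\<^sub>C fst p, c *\<^sub>C snd p)"

instance
  by standard
    (auto simp: scaleC_prod_def scaleC_add_right scaleC_add_left scaleC_scaleC
      scaleR_prod_def scaleR_scaleC)

end

lemma Re_cinner_self: "Re (cinner x x) = (norm x)\<^sup>2"
  for x :: "'a::complex_inner"
proof -
  have "0 \<le> sqrt (Re (cinner x x))"
    by (metis norm_eq_sqrt_cinner norm_ge_zero)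
  then show ?thesis
    by (simp add: norm_eq_sqrt_cinner)
qed

instantiation prod :: (complex_inner, complex_inner) complex_inner
begin

definition cinner_prod :: "'a \<times> 'b \<Rightarrow> 'a \<times> 'b \<Rightarrow> complex"
  where "cinner_prod p q = cinner (fst p) (fst q) + cinner (snd p) (snd q)"

instance
proof
  fix x y z :: "'a \<times> 'b" and c :: complex
  show "cinner x y = cnj (cinner y x)"
    unfolding cinner_prod_def
    by (metis cinner_commute complex_cnj_add)
  show "cinner (x + y) z = cinner x z + cinner y z"
    by (simp add: cinner_prod_def cinner_add_left)
  show "cinner (c *\<^sub>C x) y = c * cinner x y"
    by (simp add: cinner_prod_def scaleC_prod_def cinner_scaleC_left distrib_left)
  show "norm x = sqrt (Re (cinner x x))"
    by (simp add: cinner_prod_def norm_prod_def Re_cinner_self)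
qed

end

instance prod :: (chilbert_space, chilbert_space) chilbert_space ..

definition bounded_clinear :: "('a::complex_inner \<Rightarrow> 'b::complex_inner) \<Rightarrow> bool"
  where "bounded_clinear T \<longleftrightarrow> bounded_linear T \<and> (\<forall>c x. T (c *\<^sub>C x) = c *\<^sub>C T x)"

definition cadjoint :: "('a::chilbert_space \<Rightarrow> 'b::chilbert_space) \<Rightarrow> 'b \<Rightarrow> 'a"
  where "cadjoint T = (THE S. \<forall>x y. cinner (T x) y = cinner x (S y))"

lemma cinner_diff_left: "cinner (x - y) z = cinner x z - cinner y z"
  for x y z :: "'a::complex_inner"
  using cinner_add_left[of "x - y" y z] by simp

lemma cinner_add_right: "cinner z (x + y) = cinner z x + cinner z y"
  for x y z :: "'a::complex_inner"
  by (metis cinner_add_left cinner_commute complex_cnj_add)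

lemma cinner_diff_right: "cinner z (x - y) = cinner z x - cinner z y"
  for x y z :: "'a::complex_inner"
  using cinner_add_right[of z "x - y" y] by simp

lemma cinner_scaleC_right: "cinner x (c *\<^sub>C y) = cnj c * cinner x y"
  for x y :: "'a::complex_inner"
  by (metis cinner_commute cinner_scaleC_left complex_cnj_mult)

lemma cinner_self: "cinner x x = complex_of_real ((norm x)\<^sup>2)"
  for x :: "'a::complex_inner"
proof -
  have "Im (cinner x x) = - Im (cinner x x)"
    by (metis cinner_commute cnj.sel(2))
  then show ?thesis
    by (simp add: complex_eq_iff Re_cinner_self)
qed

lemma cinner_cauchy_schwarz: "cmod (cinner x y) \<le> norm x * norm y"
  for x y :: "'a::complex_inner"
proof (cases "y = 0")
  case True
  then show ?thesis
    using cinner_add_right[of x 0 0] by simp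
next
  case False
  define c where "c = cinner x y"
  define n where "n = complex_of_real ((norm y)\<^sup>2)"
  have yx: "cinner y x = cnj c"
    unfolding c_def by (rule cinner_commute)
  let ?v = "n *\<^sub>C x - c *\<^sub>C y"
  have "cinner ?v ?v = n * (n * complex_of_real ((norm x)\<^sup>2) - c * cnj c)"
    by (simp add: cinner_diff_left cinner_diff_right cinner_scaleC_left cinner_scaleC_right
      yx cinner_self[of x] cinner_self[of y] flip: c_def n_def) (simp add: n_def algebra_simps)
  also have "\<dots> = complex_of_real ((norm y)\<^sup>2 * ((norm y)\<^sup>2 * (norm x)\<^sup>2 - (cmod c)\<^sup>2))"
    by (simp add: n_def complex_norm_square[symmetric])
  finally have "Re (cinner ?v ?v) = (norm y)\<^sup>2 * ((norm y)\<^sup>2 * (norm x)\<^sup>2 - (cmod c)\<^sup>2)"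
    by simp
  then have "0 \<le> (norm y)\<^sup>2 * ((norm y)\<^sup>2 * (norm x)\<^sup>2 - (cmod c)\<^sup>2)"
    by (metis Re_cinner_self zero_le_power2)
  then have "(cmod c)\<^sup>2 \<le> (norm x * norm y)\<^sup>2"
    using False by (simp add: zero_le_mult_iff power_mult_distrib mult.commute)
  then show ?thesis
    unfolding c_def by (rule power2_le_imp_le) simp
qed

text \<open>Riesz representation: the representing vector minimises
  \<open>J x = (norm x)\<^sup>2 - 2 * Re (f x)\<close>, and minimising sequences are Cauchy by the
  parallelogram law.\<close>

lemma riesz_representation:
  fixes f :: "'a::chilbert_space \<Rightarrow> complex"
  assumes bl: "bounded_linear f" and cl: "\<And>c x. f (c *\<^sub>C x) = c * f x"
  shows "\<exists>z. \<forall>x. f x = cinner x z"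
proof -
  interpret f: bounded_linear f by (rule bl)
  define J where "J x = (norm x)\<^sup>2 - 2 * Re (f x)" for x
  obtain K where K: "\<And>x. cmod (f x) \<le> norm x * K"
    using f.bounded by blast
  have lower: "- K\<^sup>2 \<le> J x" for x
  proof -
    have "Re (f x) \<le> norm x * K"
      using K[of x] complex_Re_le_cmod[of "f x"] by linarith
    moreover have "0 \<le> (norm x - K)\<^sup>2" by simp
    ultimately show ?thesis
      unfolding J_def by (simp add: power2_diff)
  qed
  define m where "m = Inf (range J)"
  have bdd: "bdd_below (range J)"
    using lower by (auto simp: bdd_below_def)
  have m_le: "m \<le> J x" for x
    unfolding m_def by (rule cInf_lower[OF rangeI bdd])
  have par: "(norm (x - y))\<^sup>2 \<le> 2 * (J x - m) + 2 * (J y - m)" for x y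
  proof -
    have "(norm (x + y))\<^sup>2 + (norm (x - y))\<^sup>2 = 2 * (norm x)\<^sup>2 + 2 * (norm y)\<^sup>2"
      by (simp add: Re_cinner_self[symmetric] cinner_add_left cinner_diff_left
        cinner_add_right cinner_diff_right)
    moreover have "J ((1/2) *\<^sub>R (x + y)) = (norm (x + y))\<^sup>2 / 4 - (Re (f x) + Re (f y))"
      by (simp add: J_def f.scaleR f.add power_divide add_divide_distrib power2_eq_square)
    moreover note m_le[of "(1/2) *\<^sub>R (x + y)"]
    ultimately show ?thesis
      unfolding J_def by (simp add: field_simps)
  qed
  have "\<exists>x. J x < m + 1 / real (Suc n)" for n
  proof -
    have "Inf (range J) < m + 1 / real (Suc n)"
      by (simp add: m_def)
    then show ?thesis
      by (subst (asm) cInf_less_iff[OF _ bdd]) auto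
  qed
  then obtain X where X: "\<And>n. J (X n) < m + 1 / real (Suc n)"
    by metis
  have "Cauchy X"
  proof (rule metric_CauchyI)
    fix e :: real assume e: "0 < e"
    then obtain N where N: "inverse (real (Suc N)) < e\<^sup>2 / 4"
      using reals_Archimedean[of "e\<^sup>2 / 4"] by auto
    have small: "4 * J (X n) - 4 * m < e\<^sup>2" if "n \<ge> N" for n
    proof -
      have "1 / real (Suc n) \<le> inverse (real (Suc N))"
        using that by (simp add: field_simps)
      then show ?thesis using X[of n] N by linarith
    qed
    have "dist (X i) (X j) < e" if "i \<ge> N" "j \<ge> N" for i j
    proof -
      have "(norm (X i - X j))\<^sup>2 < e\<^sup>2"
        using par[of "X i" "X j"] small[OF that(1)] small[OF that(2)]
        by (simp add: algebra_simps)
      then show ?thesis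
        using e by (simp add: dist_norm power_less_imp_less_base)
    qed
    then show "\<exists>N. \<forall>i\<ge>N. \<forall>j\<ge>N. dist (X i) (X j) < e" by blast
  qed
  then obtain z where z: "X \<longlonglongrightarrow> z"
    using Cauchy_convergent convergent_def by blast
  have "(\<lambda>n. J (X n)) \<longlonglongrightarrow> J z"
    unfolding J_def by (intro tendsto_intros f.tendsto z)
  moreover have "(\<lambda>n. m + 1 / real (Suc n)) \<longlonglongrightarrow> m + 0"
    by (intro tendsto_intros LIMSEQ_Suc[OF lim_1_over_n])
  ultimately have Jz: "J z \<le> m"
    using X by (intro LIMSEQ_le[of "\<lambda>n. J (X n)" "J z"]) (auto intro: less_imp_le)
  have ReEq: "Re (cinner x z) = Re (f x)" for x
  proof -
    define d where "d = Re (cinner x z) - Re (f x)"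
    have zx: "Re (cinner z x) = Re (cinner x z)"
      by (metis cinner_commute cnj.sel(1))
    have sc: "cinner (t *\<^sub>R u) v = t * cinner u v" "cinner u (t *\<^sub>R v) = t * cinner u v"
      for t and u v :: 'a
      by (simp_all add: scaleR_scaleC cinner_scaleC_left cinner_scaleC_right)
    have key: "0 \<le> 2 * t * d + t\<^sup>2 * (norm x)\<^sup>2" for t
    proof -
      have "(norm (z + t *\<^sub>R x))\<^sup>2 = (norm z)\<^sup>2 + 2 * t * Re (cinner x z) + t\<^sup>2 * (norm x)\<^sup>2"
        unfolding Re_cinner_self[symmetric]
        by (simp add: cinner_add_left cinner_add_right sc zx power2_eq_square algebra_simps)
      moreover have "Re (f (z + t *\<^sub>R x)) = Re (f z) + t * Re (f x)"
        by (simp add: f.add f.scaleR)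
      moreover have "J z \<le> J (z + t *\<^sub>R x)"
        using Jz m_le[of "z + t *\<^sub>R x"] by linarith
      ultimately show ?thesis
        unfolding J_def d_def by (simp add: algebra_simps)
    qed
    have "d = 0"
    proof (rule ccontr)
      assume d: "d \<noteq> 0"
      define s where "s = (norm x)\<^sup>2 + 1"
      have s: "0 < s" "(norm x)\<^sup>2 < s"
        by (auto simp: s_def add_nonneg_pos)
      have "2 * (- d / s) * d + (- d / s)\<^sup>2 * (norm x)\<^sup>2
        = (d\<^sup>2 / s\<^sup>2) * ((norm x)\<^sup>2 - 2 * s)"
        using s(1) by (simp add: field_simps power2_eq_square)
      also have "\<dots> < 0"
        using d s by (intro mult_pos_neg) auto
      finally show False using key[of "- d / s"] by linarith
    qed
    then show ?thesis by (simp add: d_def)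
  qed
  have "f x = cinner x z" for x
    using ReEq[of x] ReEq[of "\<i> *\<^sub>C x"]
    by (simp add: complex_eq_iff cl cinner_scaleC_left)
  then show ?thesis by blast
qed

text \<open>The description defining the adjoint is meaningful: it has exactly one solution.\<close>

lemma cadjoint_exists_unique:
  fixes T :: "'a::chilbert_space \<Rightarrow> 'b::chilbert_space"
  assumes "bounded_clinear T"
  shows "\<exists>!S. \<forall>x y. cinner (T x) y = cinner x (S y)"
proof -
  have T: "bounded_linear T" "\<And>c x. T (c *\<^sub>C x) = c *\<^sub>C T x"
    using assms by (auto simp: bounded_clinear_def)
  interpret T: bounded_linear T by (rule T(1))
  obtain K where K: "\<And>x. norm (T x) \<le> norm x * K"
    using T.bounded by blast
  have "\<exists>z. \<forall>x. cinner (T x) y = cinner x z" for y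
  proof (rule riesz_representation)
    show "bounded_linear (\<lambda>x. cinner (T x) y)"
    proof (rule bounded_linear_intro)
      fix x u :: 'a and r :: real
      show "cinner (T (x + u)) y = cinner (T x) y + cinner (T u) y"
        by (simp add: T.add cinner_add_left)
      show "cinner (T (r *\<^sub>R x)) y = r *\<^sub>R cinner (T x) y"
        by (simp add: T.scaleR scaleR_scaleC[where 'a='b] cinner_scaleC_left scaleR_conv_of_real)
      show "cmod (cinner (T x) y) \<le> norm x * (K * norm y)"
        using cinner_cauchy_schwarz[of "T x" y] mult_right_mono[OF K[of x] norm_ge_zero[of y]]
        by (simp add: mult.assoc)
    qed
  qed (simp add: T(2) cinner_scaleC_left)
  then obtain S where S: "\<forall>x y. cinner (T x) y = cinner x (S y)"
    by metis
  show ?thesis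
  proof (rule ex1I[of _ S], rule S)
    fix S' assume S': "\<forall>x y. cinner (T x) y = cinner x (S' y)"
    show "S' = S"
    proof
      fix y
      have "cinner (S' y - S y) (S' y - S y) = 0"
        using S S' by (metis cinner_diff_right diff_self)
      then show "S' y = S y" by (simp add: cinner_self)
    qed
  qed
qed

lemma cinner_cadjoint:
  assumes "bounded_clinear T"
  shows "cinner (T x) y = cinner x (cadjoint T y)"
  using theI'[OF cadjoint_exists_unique[OF assms]] unfolding cadjoint_def by blast

definition op_matrix ::
  "('a \<Rightarrow> 'a) \<Rightarrow> ('a \<Rightarrow> 'a) \<Rightarrow> ('a \<Rightarrow> 'a) \<Rightarrow> ('a \<Rightarrow> 'a) \<Rightarrow> 'a \<times> 'a \<Rightarrow> 'a \<times> 'a::complex_inner"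
  where "op_matrix A B C D = (\<lambda>(x, y). (A x + B y, C x + D y))"

text \<open>Inserting \<open>0\<close> only matters for the zero space, which has no unit vectors: the supremum
  of the empty set of nonnegative numbers is \<open>0\<close>, whereas \<open>Sup {}\<close> is unspecified on the reals.\<close>

definition numerical_radius :: "('a::complex_inner \<Rightarrow> 'a) \<Rightarrow> real"
  where "numerical_radius T = Sup (insert 0 {cmod (cinner (T x) x) | x. norm x = 1})"

definition euclidean_op_norm :: "('a::complex_inner \<Rightarrow> 'b::complex_inner) \<Rightarrow> ('a \<Rightarrow> 'b) \<Rightarrow> real"
  where "euclidean_op_norm T\<^sub>1 T\<^sub>2 =
    Sup {onorm (\<lambda>x. a *\<^sub>C T\<^sub>1 x + b *\<^sub>C T\<^sub>2 x) | a b. (cmod a)\<^sup>2 + (cmod b)\<^sup>2 = 1}"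

end

theory Submission
  imports Defs
begin

text \<open>
  For a unit vector \<open>(x, y)\<close> of the direct sum, the quadratic form of the off-diagonal matrix
  is \<open>\<langle>T\<^sub>1 y, x\<rangle> + \<langle>T\<^sub>2\<^sup>* x, y\<rangle>\<close>, and the second term is the complex conjugate of
  \<open>\<langle>T\<^sub>2 y, x\<rangle>\<close>. Its modulus is therefore at most \<open>\<bar>\<langle>T\<^sub>1 y, x\<rangle>\<bar> + \<bar>\<langle>T\<^sub>2 y, x\<rangle>\<bar>\<close>.

  Multiplying the two inner products by suitable unimodular numbers \<open>u\<close> and \<open>v\<close> makes both of
  them nonnegative, so that this sum equals \<open>\<langle>(u T\<^sub>1 + v T\<^sub>2) y, x\<rangle>\<close>. The coefficients
  \<open>u / \<surd>2\<close> and \<open>v / \<surd>2\<close> are admissible in the Euclidean operator norm, whence the bound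
  \<open>\<surd>2 \<parallel>(T\<^sub>1, T\<^sub>2)\<parallel>\<^sub>e \<parallel>x\<parallel> \<parallel>y\<parallel>\<close> of lemma \<open>sum_cmod_cinner_le_euclidean_op_norm\<close>.
  Finally \<open>\<parallel>x\<parallel> \<parallel>y\<parallel> \<le> 1/2\<close>, because \<open>\<parallel>x\<parallel>\<^sup>2 + \<parallel>y\<parallel>\<^sup>2 = 1\<close>.
\<close>

lemma norm_scaleC: "norm (c *\<^sub>C x) = cmod c * norm x"
  for x :: "'a::complex_inner"
proof -
  have "complex_of_real ((norm (c *\<^sub>C x))\<^sup>2) = c * cnj c * complex_of_real ((norm x)\<^sup>2)"
    unfolding cinner_self[symmetric] by (simp add: cinner_scaleC_left cinner_scaleC_right)
  also have "\<dots> = complex_of_real ((cmod c * norm x)\<^sup>2)"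
    by (simp add: complex_norm_square[symmetric] power_mult_distrib)
  finally have "(norm (c *\<^sub>C x))\<^sup>2 = (cmod c * norm x)\<^sup>2"
    by (simp only: of_real_eq_iff)
  then show ?thesis
    by (simp add: power2_eq_iff_nonneg)
qed

lemma bounded_linear_scaleC: "bounded_linear (\<lambda>x::'a::complex_inner. c *\<^sub>C x)"
  by (rule bounded_linear_intro[where K = "cmod c"])
    (simp_all add: scaleC_add_right scaleR_scaleC scaleC_scaleC norm_scaleC mult.commute)

lemma bounded_linear_combination:
  fixes S T :: "'a::complex_inner \<Rightarrow> 'b::complex_inner"
  assumes "bounded_linear S" and "bounded_linear T"
  shows "bounded_linear (\<lambda>x. a *\<^sub>C S x + b *\<^sub>C T x)"
  by (intro bounded_linear_add bounded_linear_compose[OF bounded_linear_scaleC] assms)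

text \<open>The supremum defining the Euclidean operator norm is taken over a set that is bounded above
  by the sum of the operator norms, since each coefficient has modulus at most one.\<close>

lemma onorm_le_euclidean_op_norm:
  fixes S T :: "'a::complex_inner \<Rightarrow> 'b::complex_inner"
  assumes S: "bounded_linear S" and T: "bounded_linear T"
    and ab: "(cmod a)\<^sup>2 + (cmod b)\<^sup>2 = 1"
  shows "onorm (\<lambda>x. a *\<^sub>C S x + b *\<^sub>C T x) \<le> euclidean_op_norm S T"
  unfolding euclidean_op_norm_def
proof (rule cSup_upper)
  show "onorm (\<lambda>x. a *\<^sub>C S x + b *\<^sub>C T x)
    \<in> {onorm (\<lambda>x. a *\<^sub>C S x + b *\<^sub>C T x) | a b. (cmod a)\<^sup>2 + (cmod b)\<^sup>2 = 1}"
    using ab by blast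
  have "onorm (\<lambda>x. c *\<^sub>C S x + d *\<^sub>C T x) \<le> onorm S + onorm T"
    if cd: "(cmod c)\<^sup>2 + (cmod d)\<^sup>2 = 1" for c d
  proof (rule onorm_bound)
    show "0 \<le> onorm S + onorm T"
      using onorm_pos_le[OF S] onorm_pos_le[OF T] by simp
  next
    fix x
    have "(cmod c)\<^sup>2 \<le> 1\<^sup>2" and "(cmod d)\<^sup>2 \<le> 1\<^sup>2"
      using cd zero_le_power2[of "cmod c"] zero_le_power2[of "cmod d"]
      unfolding one_power2 by linarith+
    then have "cmod c \<le> 1" and "cmod d \<le> 1"
      by (auto intro: power2_le_imp_le)
    then have "cmod c * norm (S x) \<le> norm (S x)" and "cmod d * norm (T x) \<le> norm (T x)"
      by (auto intro: mult_left_le_one_le)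
    then have "norm (c *\<^sub>C S x + d *\<^sub>C T x) \<le> norm (S x) + norm (T x)"
      using norm_triangle_ineq[of "c *\<^sub>C S x" "d *\<^sub>C T x"] by (simp add: norm_scaleC)
    then show "norm (c *\<^sub>C S x + d *\<^sub>C T x) \<le> (onorm S + onorm T) * norm x"
      using onorm[OF S, of x] onorm[OF T, of x] by (simp add: distrib_right)
  qed
  then show "bdd_above {onorm (\<lambda>x. a *\<^sub>C S x + b *\<^sub>C T x) | a b. (cmod a)\<^sup>2 + (cmod b)\<^sup>2 = 1}"
    unfolding bdd_above_def by blast
qed

lemma euclidean_op_norm_nonneg:
  fixes S T :: "'a::complex_inner \<Rightarrow> 'b::complex_inner"
  assumes "bounded_linear S" and "bounded_linear T"
  shows "0 \<le> euclidean_op_norm S T"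
  using onorm_pos_le[OF bounded_linear_combination[OF assms, of 1 0]]
    onorm_le_euclidean_op_norm[OF assms, of 1 0] by simp

lemma unimodular_rotation_to_modulus:
  obtains u :: complex where "cmod u = 1" and "u * z = complex_of_real (cmod z)"
proof (cases "z = 0")
  case True
  then show ?thesis using that[of 1] by simp
next
  case False
  have "cnj (sgn z) * z = complex_of_real (cmod z)"
    using False by (simp add: sgn_eq complex_norm_square[symmetric] power2_eq_square mult.commute)
  then show ?thesis using False that[of "cnj (sgn z)"] by (simp add: norm_sgn)
qed

text \<open>Rotating both inner products onto the nonnegative real axis with coefficients of equal
  modulus \<open>1 / \<surd>2\<close> turns the sum of moduli into a single inner product with an admissible
  combination of the two operators.\<close>

lemma sum_cmod_cinner_le_euclidean_op_norm:
  fixes S T :: "'a::complex_inner \<Rightarrow> 'b::complex_inner"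
  assumes S: "bounded_linear S" and T: "bounded_linear T"
  shows "cmod (cinner (S y) x) + cmod (cinner (T y) x)
    \<le> sqrt 2 * euclidean_op_norm S T * (norm x * norm y)"
proof -
  obtain u where u: "cmod u = 1" "u * cinner (S y) x = complex_of_real (cmod (cinner (S y) x))"
    by (rule unimodular_rotation_to_modulus)
  obtain v where v: "cmod v = 1" "v * cinner (T y) x = complex_of_real (cmod (cinner (T y) x))"
    by (rule unimodular_rotation_to_modulus)
  define r where "r = complex_of_real (1 / sqrt 2)"
  define L where "L z = (r * u) *\<^sub>C S z + (r * v) *\<^sub>C T z" for z
  have L: "bounded_linear L"
    unfolding L_def by (rule bounded_linear_combination[OF S T])
  have "(cmod (r * u))\<^sup>2 + (cmod (r * v))\<^sup>2 = 1"
    by (simp add: r_def norm_mult norm_divide u v power_divide)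
  then have "onorm L \<le> euclidean_op_norm S T"
    unfolding L_def by (rule onorm_le_euclidean_op_norm[OF S T])
  then have Ly: "norm (L y) \<le> euclidean_op_norm S T * norm y"
    by (intro order_trans[OF onorm[OF L, of y]] mult_right_mono norm_ge_zero)
  have "cinner (L y) x = r * (u * cinner (S y) x + v * cinner (T y) x)"
    by (simp add: L_def cinner_add_left cinner_scaleC_left algebra_simps)
  also have "\<dots> = complex_of_real ((cmod (cinner (S y) x) + cmod (cinner (T y) x)) / sqrt 2)"
    by (simp add: u v r_def)
  finally have "cmod (cinner (L y) x)
      = \<bar>(cmod (cinner (S y) x) + cmod (cinner (T y) x)) / sqrt 2\<bar>"
    by (simp only: norm_of_real)
  then have "cmod (cinner (S y) x) + cmod (cinner (T y) x) = sqrt 2 * cmod (cinner (L y) x)"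
    by simp
  also have "\<dots> \<le> sqrt 2 * (norm (L y) * norm x)"
    by (intro mult_left_mono cinner_cauchy_schwarz) simp
  also have "\<dots> \<le> sqrt 2 * (euclidean_op_norm S T * norm y * norm x)"
    by (intro mult_left_mono mult_right_mono Ly) simp_all
  finally show ?thesis by (simp add: mult_ac)
qed

theorem theorem2p1:
  fixes T\<^sub>1 T\<^sub>2 :: "'a::chilbert_space \<Rightarrow> 'a"
  assumes "bounded_clinear T\<^sub>1" and "bounded_clinear T\<^sub>2"
  shows "numerical_radius (op_matrix (\<lambda>x. 0) T\<^sub>1 (cadjoint T\<^sub>2) (\<lambda>x. 0))
    \<le> 1 / sqrt 2 * euclidean_op_norm T\<^sub>1 T\<^sub>2"
proof -
  let ?M = "op_matrix (\<lambda>x. 0) T\<^sub>1 (cadjoint T\<^sub>2) (\<lambda>x. 0)"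
  define E where "E = euclidean_op_norm T\<^sub>1 T\<^sub>2"
  have bl: "bounded_linear T\<^sub>1" "bounded_linear T\<^sub>2"
    using assms by (simp_all add: bounded_clinear_def)
  have E0: "0 \<le> E"
    unfolding E_def by (rule euclidean_op_norm_nonneg[OF bl])
  have bound: "cmod (cinner (?M p) p) \<le> 1 / sqrt 2 * E" if "norm p = 1" for p
  proof -
    obtain x y where p: "p = (x, y)" by (cases p)
    have xy: "(norm x)\<^sup>2 + (norm y)\<^sup>2 = 1"
      using that by (simp add: p norm_prod_def)
    have half: "norm x * norm y \<le> 1 / 2"
      using zero_le_power2[of "norm x - norm y"] xy by (simp add: power2_diff)
    have "cinner (cadjoint T\<^sub>2 x) y = cnj (cinner (T\<^sub>2 y) x)"
      by (metis cinner_cadjoint[OF assms(2)] cinner_commute)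
    then have "cmod (cinner (?M p) p) = cmod (cinner (T\<^sub>1 y) x + cnj (cinner (T\<^sub>2 y) x))"
      by (simp add: p op_matrix_def cinner_prod_def)
    also have "\<dots> \<le> cmod (cinner (T\<^sub>1 y) x) + cmod (cinner (T\<^sub>2 y) x)"
      by (metis norm_triangle_ineq complex_mod_cnj)
    also have "\<dots> \<le> sqrt 2 * E * (norm x * norm y)"
      unfolding E_def by (rule sum_cmod_cinner_le_euclidean_op_norm[OF bl])
    also have "\<dots> \<le> sqrt 2 * E * (1 / 2)"
      using half E0 by (intro mult_left_mono) simp_all
    also have "\<dots> = 1 / sqrt 2 * E"
      by (simp add: field_simps)
    finally show ?thesis .
  qed
  show ?thesis
    unfolding numerical_radius_def E_def[symmetric]
  proof (rule cSup_least)
    fix r assume "r \<in> insert 0 {cmod (cinner (?M p) p) | p. norm p = 1}"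
    then show "r \<le> 1 / sqrt 2 * E"
      using bound E0 by auto
  qed simp
qed

end
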